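(* Consider the system $\dot{\mathbf x}=f(\mathbf x)+g(\mathbf x)\mathbf u$, $\mathbf u(t)\in\mathcal U$, on $[0,T]$ with $\mathbf x(0)=\mathbf x_0\in\mathcal X_0$, and an STL specification $\varphi$ of the form given in the context with predicates $\mu_j: h_j(\mathbf x)\ge0$, $j=1,\dots,M$, such that: (A1) for every $\mathbf x(0)\in\mathcal X_0$ there exists $\mathbf u(t)\in\mathcal U$ such that the resulting solution satisfies $(\mathbf x,0)\models\varphi$; (A2) for every predicate in Category II or III, $h(\mathbf x)=s\big(R-\sigma(l(\mathbf x)-\mathbf o)\big)$, where $s\in\{-1,1\}$, $R>0$, $\mathbf o\in\mathbb R^{o}$, $l:\mathbb R^n\to\mathbb R^{o}$ is differentiable and $\sigma:\mathbb R^{o}\to\mathbb R_{\ge0}$ is a smooth, strictly convex, radially unbounded gauge function (e.g. the Euclidean norm or a superelliptic norm). Let HOCBFs $b_j$ be constructed from the predicates as in the context ($b_j=h_j$ for Category I; $b_j=h_j+\gamma_j$ for Categories II and III), with the functions $\gamma_j$ satisfying the constraints (F) for Category II, (G) for Category III, and the nonconflict conditions (N), all stated in the context. Suppose each HOCBF satisfies $\psi_{i,j}(\mathbf x_0,0)\ge0$ for $i=0,\dots,m-1$, $j=1,\dots,M$. Then any control input $\mathbf u(t)$ that satisfies the HOCBF constraint $\psi_{m,j}(\mathbf x(t),t,\mathbf u(t))\ge0$ for all relevant (i.e. not yet deleted, according to the deletion rules in the context) HOCBFs guarantees satisfaction of the STL specification: $(\mathbf x,0)\models\varphi$.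
   Context: System: $\mathbf x(t)\in\mathbb R^n$, $\mathcal U\subset\mathbb R^q$ a compact box, $f,g$ locally Lipschitz, $\mathcal X_0\subseteq\mathbb R^n$ the set of initial states. STL. $\phi::=\top\mid\mu\mid\neg\mu\mid\phi_1\wedge\phi_2$ and $\varphi::=F_{[t_a,t_b]}\phi\mid G_{[t_a,t_b]}\phi\mid\varphi_1\wedge\varphi_2$, with $t_a<t_b$ and $\mu$ a predicate $h(\mathbf x)\ge0$. Without loss of generality $\varphi$ is negation-free. $(\mathbf x,0)\models F_{[t_a,t_b]}\phi$ iff $\phi$ holds at $\mathbf x(t)$ for some $t\in[t_a,t_b]$; $(\mathbf x,0)\models G_{[t_a,t_b]}\phi$ iff $\phi$ holds at $\mathbf x(t)$ for all $t\in[t_a,t_b]$; conjunction is standard. $T$ is the time horizon of $\varphi$ (the earliest time needed to decide its satisfaction). Categories of predicates. Category I: predicates with $h(\mathbf x_0)\ge0$ whose enclosing temporal operator starts at $t_a=0$. Category II: predicates enclosed by $F_{[t_a,t_b]}$ not in Category I. Category III: predicates enclosed by $G_{[t_a,t_b]}$ not in Category I. HOCBFs. A class $\kappa$ function is a continuous strictly increasing $\alpha:[0,a)\to[0,+\infty]$ with $\alpha(0)=0$. For $b_j(\mathbf x,t)$ of relative degree $m$ (number of differentiations along the dynamics until $\mathbf u$ appears explicitly), set $\psi_{0,j}=b_j$ and $\psi_{i,j}=\dot\psi_{i-1,j}+\alpha_{i,j}(\psi_{i-1,j})$, $i=1,\dots,m$, with $\alpha_{i,j}$ an $(m-i)$-times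 differentiable class $\kappa$ function (possibly including a positive multiplier) and the dot the total derivative along the dynamics; $\psi_{m,j}$ depends on $(\mathbf x,t,\mathbf u)$. $b_j$ is an HOCBF if such $\alpha_{i,j}$ exist with $\sup_{\mathbf u\in\mathcal U}\psi_{m,j}(\mathbf x,t,\mathbf u)\ge0$ for all $t\in[0,T]$ and all $\mathbf x$ with $\psi_{i,j}(\mathbf x,t)\ge0$, $i=0,\dots,m-1$. Known fact: if $\psi_{i,j}(\mathbf x_0,0)\ge0$ for $i=0,\dots,m-1$, any Lipschitz continuous control satisfying $\psi_{m,j}\ge0$ for all $t$ keeps $\psi_{i,j}(\mathbf x(t),t)\ge0$, $i=0,\dots,m-1$, for all $t$. Construction. Category I: $b_j(\mathbf x)=h_j(\mathbf x)$ (and $\gamma_j\equiv0$). Categories II and III: $b_j(\mathbf x,t)=h_j(\mathbf x)+\gamma_j(t)$. For Category II under $F_{[t_a,t_b]}$: $\gamma(t)=\omega_1+\omega_2t$ with $\omega_1>0$, $\omega_2<0$. For Category III under $G_{[t_a,t_b]}$: $\gamma(t)=\omega_1e^{-\omega_2t}-c$ with $\omega_1,\omega_2>0$ and $c>0$ a small constant. (F), Category II: $\gamma(0)>-h(\mathbf x_0)$; $\gamma(t_b)<0$; $\gamma(t_a)>-\sup_{\mathbf x\in\mathbb R^n}h(\mathbf x)$. (G), Category III: $\gamma(0)>-h(\mathbf x_0)$; $\gamma(t_a)<0$. (N): order the predicates by ending times $t_b^1\le\cdots\le t_b^M$; for $2\le j\le M$ and $k=1,\dots,j-1$, $$\gamma_j(t_b^k)\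 \ge\ s_js_k\,\sigma(\mathbf o_j-\mathbf o_k)-\gamma_k(t_b^k)-s_kR_k-s_jR_j+D_{j,k},$$ where $h_k(\mathbf x)=s_k(R_k-\sigma(l(\mathbf x)-\mathbf o_k))$ and $D_{j,k}=\min(s_j+s_k,0)\cdot\infty$ (with $0\cdot\infty=0$), so that the condition is void when $s_j=s_k=-1$. Deletion rules. The HOCBF of a predicate under $G_{[t_a,t_b]}$ is deleted at $t=t_b$. For $F_{[t_a,t_b]}\mu$ it is deleted once $h(\mathbf x)\ge0$ at some $t\ge t_a$. For $F_{[t_a,t_b]}(\bigwedge_{j=1}^N\mu_j)$ all corresponding HOCBFs are deleted together once $h_j(\mathbf x)\ge0$ for all $j$ simultaneously at some $t\ge t_a$. A deleted HOCBF no longer imposes a constraint. *)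

theory Defs
  imports "HOL-Analysis.Analysis"
begin

text \<open>Atoms are occurrences of predicates, named by an index \<open>j\<close>; the predicate itself is
  \<open>h j x \<ge> 0\<close>.  Two indices may carry the same function \<open>h j\<close>, so a predicate that occurs under
  several temporal operators gets one index (hence one barrier function) per occurrence.\<close>

datatype state_fm =
    STrue
  | SPred nat
  | SNegPred nat
  | SAnd state_fm state_fm

datatype stl =
    Eventually real real state_fm
  | Always real real state_fm
  | Conj stl stl

fun sat_state :: "(nat \<Rightarrow> 'x \<Rightarrow> real) \<Rightarrow> 'x \<Rightarrow> state_fm \<Rightarrow> bool" where
  "sat_state h x STrue \<longleftrightarrow> True"
| "sat_state h x (SPred j) \<longleftrightarrow> 0 \<le> h j x"
| "sat_state h x (SNegPred j) \<longleftrightarrow> \<not> 0 \<le> h j x"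
| "sat_state h x (SAnd \<theta>1 \<theta>2) \<longleftrightarrow> sat_state h x \<theta>1 \<and> sat_state h x \<theta>2"

text \<open>Satisfaction of a specification at time 0.\<close>

fun sat :: "(nat \<Rightarrow> 'x \<Rightarrow> real) \<Rightarrow> (real \<Rightarrow> 'x) \<Rightarrow> stl \<Rightarrow> bool" where
  "sat h x (Eventually a b \<theta>) \<longleftrightarrow> (\<exists>t\<in>{a..b}. sat_state h (x t) \<theta>)"
| "sat h x (Always a b \<theta>) \<longleftrightarrow> (\<forall>t\<in>{a..b}. sat_state h (x t) \<theta>)"
| "sat h x (Conj \<phi>1 \<phi>2) \<longleftrightarrow> sat h x \<phi>1 \<and> sat h x \<phi>2"

fun state_atoms :: "state_fm \<Rightarrow> nat list" where
  "state_atoms STrue = []"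
| "state_atoms (SPred j) = [j]"
| "state_atoms (SNegPred j) = [j]"
| "state_atoms (SAnd \<theta>1 \<theta>2) = state_atoms \<theta>1 @ state_atoms \<theta>2"

fun atoms :: "stl \<Rightarrow> nat list" where
  "atoms (Eventually a b \<theta>) = state_atoms \<theta>"
| "atoms (Always a b \<theta>) = state_atoms \<theta>"
| "atoms (Conj \<phi>1 \<phi>2) = atoms \<phi>1 @ atoms \<phi>2"

fun state_negation_free :: "state_fm \<Rightarrow> bool" where
  "state_negation_free (SNegPred j) \<longleftrightarrow> False"
| "state_negation_free (SAnd \<theta>1 \<theta>2) \<longleftrightarrow> state_negation_free \<theta>1 \<and> state_negation_free \<theta>2"
| "state_negation_free _ \<longleftrightarrow> True"

fun negation_free :: "stl \<Rightarrow> bool" where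
  "negation_free (Eventually a b \<theta>) \<longleftrightarrow> state_negation_free \<theta>"
| "negation_free (Always a b \<theta>) \<longleftrightarrow> state_negation_free \<theta>"
| "negation_free (Conj \<phi>1 \<phi>2) \<longleftrightarrow> negation_free \<phi>1 \<and> negation_free \<phi>2"

fun well_timed :: "stl \<Rightarrow> bool" where
  "well_timed (Eventually a b \<theta>) \<longleftrightarrow> 0 \<le> a \<and> a < b"
| "well_timed (Always a b \<theta>) \<longleftrightarrow> 0 \<le> a \<and> a < b"
| "well_timed (Conj \<phi>1 \<phi>2) \<longleftrightarrow> well_timed \<phi>1 \<and> well_timed \<phi>2"

fun horizon :: "stl \<Rightarrow> real" where
  "horizon (Eventually a b \<theta>) = b"
| "horizon (Always a b \<theta>) = b"
| "horizon (Conj \<phi>1 \<phi>2) = max (horizon \<phi>1) (horizon \<phi>2)"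

text \<open>The temporal subformula enclosing atom \<open>j\<close>; meaningful when the atoms of \<open>\<phi>\<close> are
  distinct and \<open>j\<close> is one of them.\<close>

fun enclosing :: "stl \<Rightarrow> nat \<Rightarrow> stl" where
  "enclosing (Conj \<phi>1 \<phi>2) j =
     (if j \<in> set (atoms \<phi>1) then enclosing \<phi>1 j else enclosing \<phi>2 j)"
| "enclosing (Eventually a b \<theta>) j = Eventually a b \<theta>"
| "enclosing (Always a b \<theta>) j = Always a b \<theta>"

fun start_of :: "stl \<Rightarrow> real" where
  "start_of (Eventually a b \<theta>) = a"
| "start_of (Always a b \<theta>) = a"
| "start_of (Conj \<phi>1 \<phi>2) = min (start_of \<phi>1) (start_of \<phi>2)"

definition t_start :: "stl \<Rightarrow> nat \<Rightarrow> real" where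
  "t_start \<phi> j = start_of (enclosing \<phi> j)"

definition t_end :: "stl \<Rightarrow> nat \<Rightarrow> real" where
  "t_end \<phi> j = horizon (enclosing \<phi> j)"

definition under_F :: "stl \<Rightarrow> nat \<Rightarrow> bool" where
  "under_F \<phi> j \<longleftrightarrow> (\<exists>a b \<theta>. enclosing \<phi> j = Eventually a b \<theta>)"

definition under_G :: "stl \<Rightarrow> nat \<Rightarrow> bool" where
  "under_G \<phi> j \<longleftrightarrow> (\<exists>a b \<theta>. enclosing \<phi> j = Always a b \<theta>)"

definition cat_I :: "(nat \<Rightarrow> 'x \<Rightarrow> real) \<Rightarrow> 'x \<Rightarrow> stl \<Rightarrow> nat \<Rightarrow> bool" where
  "cat_I h x0 \<phi> j \<longleftrightarrow> 0 \<le> h j x0 \<and> t_start \<phi> j = 0"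

definition cat_II :: "(nat \<Rightarrow> 'x \<Rightarrow> real) \<Rightarrow> 'x \<Rightarrow> stl \<Rightarrow> nat \<Rightarrow> bool" where
  "cat_II h x0 \<phi> j \<longleftrightarrow> under_F \<phi> j \<and> \<not> cat_I h x0 \<phi> j"

definition cat_III :: "(nat \<Rightarrow> 'x \<Rightarrow> real) \<Rightarrow> 'x \<Rightarrow> stl \<Rightarrow> nat \<Rightarrow> bool" where
  "cat_III h x0 \<phi> j \<longleftrightarrow> under_G \<phi> j \<and> \<not> cat_I h x0 \<phi> j"

text \<open>Caratheodory solutions: the differential equation holds almost everywhere, so that controls
  need not be continuous (they typically jump when a constraint is deleted).  The control values
  lie in a compact set and \<open>f\<close>, \<open>g\<close> are continuous, so absolute continuity of \<open>x\<close> amounts to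
  Lipschitz continuity on \<open>[0, T]\<close>.\<close>

definition trajectory ::
  "(real^'n \<Rightarrow> real^'n) \<Rightarrow> (real^'n \<Rightarrow> real^'q^'n) \<Rightarrow> (real^'q) set \<Rightarrow> real \<Rightarrow> real^'n
    \<Rightarrow> (real \<Rightarrow> real^'q) \<Rightarrow> (real \<Rightarrow> real^'n) \<Rightarrow> bool" where
  "trajectory f g U T x0 u x \<longleftrightarrow>
     x 0 = x0 \<and> (\<forall>t\<in>{0..T}. u t \<in> U) \<and> (\<exists>L. L-lipschitz_on {0..T} x) \<and>
     (\<exists>N. negligible N \<and> (\<forall>t\<in>{0..T} - N.
        (x has_vector_derivative (f (x t) + g (x t) *v u t)) (at t within {0..T})))"

text \<open>Functions of state and time are functions on \<open>real^'n \<times> real\<close>.  They are differentiated on an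
  open set \<open>D\<close> only: a norm, and hence a barrier function built from one, is not differentiable at
  the origin.

  \<open>drift_deriv f b k\<close> is the \<open>k\<close>-th total derivative of \<open>b\<close> as long as \<open>u\<close> does not appear
  in it; the term in \<open>u\<close> of the next total derivative at \<open>p = (x, t)\<close> is the derivative at \<open>p\<close>
  in direction \<open>(g x *v u, 0)\<close>.\<close>

primrec drift_deriv ::
  "(real^'n \<Rightarrow> real^'n) \<Rightarrow> ((real^'n) \<times> real \<Rightarrow> real) \<Rightarrow> nat \<Rightarrow> (real^'n) \<times> real \<Rightarrow> real" where
  "drift_deriv f b 0 = b"
| "drift_deriv f b (Suc k) =
     (\<lambda>p. frechet_derivative (drift_deriv f b k) (at p) (f (fst p), 1))"

definition relative_degree ::
  "(real^'n \<Rightarrow> real^'n) \<Rightarrow> (real^'n \<Rightarrow> real^'q^'n) \<Rightarrow> ((real^'n) \<times> real) set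
    \<Rightarrow> ((real^'n) \<times> real \<Rightarrow> real) \<Rightarrow> nat \<Rightarrow> bool" where
  "relative_degree f g D b m \<longleftrightarrow>
     0 < m \<and>
     (\<forall>k<m. \<forall>p\<in>D. drift_deriv f b k differentiable (at p)) \<and>
     (\<forall>k<m - 1. \<forall>p\<in>D. \<forall>u.
        frechet_derivative (drift_deriv f b k) (at p) (g (fst p) *v u, 0) = 0) \<and>
     (\<exists>p\<in>D. \<exists>u.
        frechet_derivative (drift_deriv f b (m - 1)) (at p) (g (fst p) *v u, 0) \<noteq> 0)"

text \<open>A continuous strictly increasing function on \<open>[0, a)\<close> cannot take the value \<open>+\<infinity>\<close>, so real
  values suffice.\<close>

definition class_kappa :: "ereal \<Rightarrow> (real \<Rightarrow> real) \<Rightarrow> bool" where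
  "class_kappa a \<alpha> \<longleftrightarrow>
     0 < a \<and> \<alpha> 0 = 0 \<and>
     continuous_on {r. 0 \<le> r \<and> ereal r < a} \<alpha> \<and>
     strict_mono_on {r. 0 \<le> r \<and> ereal r < a} \<alpha>"

definition times_differentiable_on :: "nat \<Rightarrow> real set \<Rightarrow> (real \<Rightarrow> real) \<Rightarrow> bool" where
  "times_differentiable_on k S \<alpha> \<longleftrightarrow> (\<forall>i<k. \<forall>r\<in>S. (deriv ^^ i) \<alpha> differentiable (at r))"

text \<open>\<open>psi f b \<alpha> i\<close> is used for \<open>i < m\<close>, where the total derivative does not involve \<open>u\<close>;
  \<open>psi_top\<close> is the last function of the sequence.\<close>

primrec psi ::
  "(real^'n \<Rightarrow> real^'n) \<Rightarrow> ((real^'n) \<times> real \<Rightarrow> real) \<Rightarrow> (nat \<Rightarrow> real \<Rightarrow> real) \<Rightarrow> nat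
    \<Rightarrow> (real^'n) \<times> real \<Rightarrow> real" where
  "psi f b \<alpha> 0 = b"
| "psi f b \<alpha> (Suc i) =
     (\<lambda>p. frechet_derivative (psi f b \<alpha> i) (at p) (f (fst p), 1) + \<alpha> (Suc i) (psi f b \<alpha> i p))"

definition psi_top ::
  "(real^'n \<Rightarrow> real^'n) \<Rightarrow> (real^'n \<Rightarrow> real^'q^'n) \<Rightarrow> ((real^'n) \<times> real \<Rightarrow> real)
    \<Rightarrow> (nat \<Rightarrow> real \<Rightarrow> real) \<Rightarrow> nat \<Rightarrow> (real^'n) \<times> real \<Rightarrow> real^'q \<Rightarrow> real" where
  "psi_top f g b \<alpha> m p u =
     frechet_derivative (psi f b \<alpha> (m - 1)) (at p) (f (fst p) + g (fst p) *v u, 1)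
     + \<alpha> m (psi f b \<alpha> (m - 1) p)"

text \<open>\<open>b\<close> is a HOCBF on \<open>D\<close>, with the class kappa functions \<open>\<alpha> i : [0, a i) \<rightarrow> \<real>\<close> as witnesses.

  Off the safe set \<open>\<psi>\<^sub>i\<close> is negative, so for the constraint to be a condition on the control the
  \<open>\<alpha> i\<close> have to be extended to negative arguments.  Any extension to \<open>(-\<infinity>, a i)\<close> that keeps the
  prescribed differentiability is admitted; \<open>\<alpha> m\<close>, which need not be differentiable, is to be
  nonpositive there.  Extended class kappa functions are included; requiring monotonicity of the
  extension of every \<open>\<alpha> i\<close> would exclude \<open>\<alpha> i r = r\<^sup>2\<close> when two derivatives are needed.
  The condition \<open>\<psi>\<^sub>i\<^sub>-\<^sub>1 < a i\<close> on \<open>D\<close> says that \<open>\<psi>\<^sub>i\<close> is defined on \<open>D\<close>.\<close>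

definition hocbf ::
  "(real^'n \<Rightarrow> real^'n) \<Rightarrow> (real^'n \<Rightarrow> real^'q^'n) \<Rightarrow> (real^'q) set \<Rightarrow> real
    \<Rightarrow> ((real^'n) \<times> real) set \<Rightarrow> ((real^'n) \<times> real \<Rightarrow> real) \<Rightarrow> nat \<Rightarrow> (nat \<Rightarrow> ereal)
    \<Rightarrow> (nat \<Rightarrow> real \<Rightarrow> real) \<Rightarrow> bool" where
  "hocbf f g U T D b m a \<alpha> \<longleftrightarrow>
     open D \<and> relative_degree f g D b m \<and>
     (\<forall>i\<in>{1..m}. class_kappa (a i) (\<alpha> i) \<and>
        times_differentiable_on (m - i) {r. ereal r < a i} (\<alpha> i) \<and>
        (\<forall>p\<in>D. ereal (psi f b \<alpha> (i - 1) p) < a i)) \<and>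
     (\<forall>r<0. \<alpha> m r \<le> 0) \<and>
     (\<forall>t\<in>{0..T}. \<forall>x. (x, t) \<in> D \<longrightarrow> (\<forall>i<m. 0 \<le> psi f b \<alpha> i (x, t)) \<longrightarrow>
        0 \<le> (SUP u\<in>U. ereal (psi_top f g b \<alpha> m (x, t) u)))"

primrec Ck_on :: "nat \<Rightarrow> 'a::euclidean_space set \<Rightarrow> ('a \<Rightarrow> real) \<Rightarrow> bool" where
  "Ck_on 0 S \<sigma> \<longleftrightarrow> continuous_on S \<sigma>"
| "Ck_on (Suc k) S \<sigma> \<longleftrightarrow>
     (\<forall>z\<in>S. \<sigma> differentiable (at z)) \<and>
     (\<forall>v. Ck_on k S (\<lambda>z. frechet_derivative \<sigma> (at z) v))"

text \<open>A gauge is linear along rays, so it is neither strictly convex as a function nor smooth at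
  the origin (the Euclidean norm is not).  As usual for gauges and norms, strict convexity is that
  of the unit ball, and smoothness is required away from the origin.\<close>

definition strictly_convex_gauge :: "('a::euclidean_space \<Rightarrow> real) \<Rightarrow> bool" where
  "strictly_convex_gauge \<sigma> \<longleftrightarrow>
     (\<forall>z. 0 \<le> \<sigma> z) \<and>
     (\<forall>c\<ge>0. \<forall>z. \<sigma> (c *\<^sub>R z) = c * \<sigma> z) \<and>
     (\<forall>y z. \<sigma> (y + z) \<le> \<sigma> y + \<sigma> z) \<and>
     (\<forall>y z c. y \<noteq> z \<longrightarrow> \<sigma> y \<le> 1 \<longrightarrow> \<sigma> z \<le> 1 \<longrightarrow> 0 < c \<longrightarrow> c < 1 \<longrightarrow>
        \<sigma> ((1 - c) *\<^sub>R y + c *\<^sub>R z) < 1) \<and>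
     (\<forall>k. Ck_on k (- {0}) \<sigma>) \<and>
     filterlim \<sigma> at_top at_infinity"

definition gauge_shape ::
  "('o::euclidean_space \<Rightarrow> real) \<Rightarrow> ('x \<Rightarrow> 'o) \<Rightarrow> real \<Rightarrow> real \<Rightarrow> 'o \<Rightarrow> ('x \<Rightarrow> real) \<Rightarrow> bool" where
  "gauge_shape \<sigma> l s R c h \<longleftrightarrow>
     s \<in> {-1, 1} \<and> 0 < R \<and> (\<forall>x. h x = s * (R - \<sigma> (l x - c)))"

definition gamma_form ::
  "(nat \<Rightarrow> 'x \<Rightarrow> real) \<Rightarrow> 'x \<Rightarrow> stl \<Rightarrow> nat \<Rightarrow> (real \<Rightarrow> real) \<Rightarrow> bool" where
  "gamma_form h x0 \<phi> j \<gamma> \<longleftrightarrow>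
     (cat_I h x0 \<phi> j \<longrightarrow> (\<forall>t. \<gamma> t = 0)) \<and>
     (cat_II h x0 \<phi> j \<longrightarrow> (\<exists>w1 w2. 0 < w1 \<and> w2 < 0 \<and> (\<forall>t. \<gamma> t = w1 + w2 * t))) \<and>
     (cat_III h x0 \<phi> j \<longrightarrow>
        (\<exists>w1 w2 c. 0 < w1 \<and> 0 < w2 \<and> 0 < c \<and> (\<forall>t. \<gamma> t = w1 * exp (- w2 * t) - c)))"

definition cond_F :: "('x \<Rightarrow> real) \<Rightarrow> 'x \<Rightarrow> real \<Rightarrow> real \<Rightarrow> (real \<Rightarrow> real) \<Rightarrow> bool" where
  "cond_F h x0 ta tb \<gamma> \<longleftrightarrow>
     \<gamma> 0 > - h x0 \<and> \<gamma> tb < 0 \<and> ereal (\<gamma> ta) > - (SUP x. ereal (h x))"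

definition cond_G :: "('x \<Rightarrow> real) \<Rightarrow> 'x \<Rightarrow> real \<Rightarrow> (real \<Rightarrow> real) \<Rightarrow> bool" where
  "cond_G h x0 ta \<gamma> \<longleftrightarrow> \<gamma> 0 > - h x0 \<and> \<gamma> ta < 0"

text \<open>\<open>tbk\<close> is the ending time of the predicate with index \<open>k\<close>.  In \<open>ereal\<close>, \<open>0 * \<infinity> = 0\<close>.\<close>

definition cond_N ::
  "('o::euclidean_space \<Rightarrow> real) \<Rightarrow> (nat \<Rightarrow> real) \<Rightarrow> (nat \<Rightarrow> real) \<Rightarrow> (nat \<Rightarrow> 'o)
    \<Rightarrow> (nat \<Rightarrow> real \<Rightarrow> real) \<Rightarrow> real \<Rightarrow> nat \<Rightarrow> nat \<Rightarrow> bool" where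
  "cond_N \<sigma> s R c \<gamma> tbk j k \<longleftrightarrow>
     ereal (\<gamma> j tbk) \<ge>
       ereal (s j * s k * \<sigma> (c j - c k) - \<gamma> k tbk - s k * R k - s j * R j)
       + ereal (min (s j + s k) 0) * \<infinity>"

text \<open>Whether the barrier function of predicate \<open>j\<close> still imposes a constraint at time \<open>t\<close>.
  Predicates below the same \<open>Eventually\<close> are deleted together.\<close>

definition active :: "(nat \<Rightarrow> 'x \<Rightarrow> real) \<Rightarrow> stl \<Rightarrow> (real \<Rightarrow> 'x) \<Rightarrow> nat \<Rightarrow> real \<Rightarrow> bool" where
  "active h \<phi> x j t \<longleftrightarrow>
     (case enclosing \<phi> j of
        Always a b \<theta> \<Rightarrow> t < b
      | Eventually a b \<theta> \<Rightarrow> \<not> (\<exists>\<tau>\<in>{a..t}. \<forall>i\<in>set (state_atoms \<theta>). 0 \<le> h i (x \<tau>))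
      | Conj \<phi>1 \<phi>2 \<Rightarrow> False)"

end

theory Submission
  imports Defs
begin

text \<open>Each \<open>\<psi>\<^sub>i\<close>, evaluated along the solution, satisfies a differential inequality
  \<open>y' \<ge> - \<alpha>\<^sub>i\<^sub>+\<^sub>1 y\<close> almost everywhere as long as \<open>\<psi>\<^sub>i\<^sub>+\<^sub>1 \<ge> 0\<close>, so backward induction on \<open>i\<close> keeps every
  active barrier \<open>h\<^sub>j + \<gamma>\<^sub>j\<close> nonnegative.  At the times that matter \<open>\<gamma>\<^sub>j \<le> 0\<close>, whence
  \<open>h\<^sub>j \<ge> 0\<close>: throughout the interval for \<open>Always\<close>, and at its end for an \<open>Eventually\<close> whose barriers
  have not been deleted, which would delete them.  The \<open>\<psi>\<^sub>i\<close> are only differentiable, not \<open>C\<^sup>1\<close>, so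
  \<open>y\<close> need not be absolutely continuous; but a pointwise Lipschitz bound at every time suffices to
  conclude monotonicity from the almost everywhere sign of the derivative.\<close>

subsection \<open>Differential inequalities along a curve\<close>

text \<open>A decreasing \<open>y\<close>, tilted slightly, takes some value \<open>v\<close> outside the null image of the
  exceptional set; at the last time of value \<open>v\<close> its derivative is positive, a contradiction.\<close>

lemma ae_deriv_nonneg_imp_le:
  fixes y :: "real \<Rightarrow> real"
  assumes "p \<le> q" and cont: "continuous_on {p..q} y" and "negligible N"
    and lip: "\<And>t. t \<in> {p..q} \<Longrightarrow>
      \<exists>B d. 0 < d \<and> (\<forall>s\<in>{p..q}. \<bar>s - t\<bar> < d \<longrightarrow> \<bar>y s - y t\<bar> \<le> B * \<bar>s - t\<bar>)"
    and der: "\<And>t. t \<in> {p<..<q} - N \<Longrightarrow>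
      \<exists>d\<ge>0. (y has_real_derivative d) (at t within {p..q})"
  shows "y p \<le> y q"
proof (rule ccontr)
  assume "\<not> y p \<le> y q"
  then have less: "y q < y p" and pq: "p < q"
    using \<open>p \<le> q\<close> by (auto simp: not_le less_le)
  \<comment> \<open>The tilt is half the mean rate of decrease: \<open>z\<close> still falls over
    the interval, by half the drop of \<open>y\<close>, while its derivative exceeds that of
    \<open>y\<close> by \<open>e\<close>.\<close>
  define e where "e = (y p - y q) / (2 * (q - p))"
  have e: "0 < e" and eq: "e * (q - p) = (y p - y q) / 2"
    using less pq by (auto simp: e_def field_simps)
  define z where "z t = y t + e * (t - p)" for t
  have zq: "z q < z p"
    using less eq by (simp add: z_def)
  have zcont: "continuous_on {p..q} z"
    unfolding z_def by (intro continuous_intros cont)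
  \<comment> \<open>The endpoints join the exceptional set, so that a time of \<open>{p..q}\<close>
    outside \<open>E\<close> is interior and \<open>der\<close> applies there.\<close>
  define E where "E = (N \<union> {p, q}) \<inter> {p..q}"
  have "negligible E"
    unfolding E_def using \<open>negligible N\<close> by (intro negligible_Int) auto
  \<comment> \<open>A map of the line that is Lipschitz at each point of a null set, with a constant
    depending on the point, has a null image on that set.\<close>
  have "negligible (z ` E)"
  proof (rule negligible_locally_Lipschitz_image[OF order_refl \<open>negligible E\<close>])
    fix t assume "t \<in> E"
    then obtain B d where Bd: "0 < d"
      "\<And>s. s \<in> {p..q} \<Longrightarrow> \<bar>s - t\<bar> < d \<Longrightarrow> \<bar>y s - y t\<bar> \<le> B * \<bar>s - t\<bar>"
      using lip[of t] unfolding E_def by blast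
    have "\<bar>z s - z t\<bar> \<le> (B + e) * \<bar>s - t\<bar>" if "s \<in> E" "\<bar>s - t\<bar> < d" for s
    proof -
      have "z s - z t = (y s - y t) + e * (s - t)"
        by (simp add: z_def algebra_simps)
      then have "\<bar>z s - z t\<bar> \<le> \<bar>y s - y t\<bar> + e * \<bar>s - t\<bar>"
        using e abs_triangle_ineq[of "y s - y t" "e * (s - t)"] by (simp add: abs_mult)
      moreover have "\<bar>y s - y t\<bar> \<le> B * \<bar>s - t\<bar>"
        using Bd that unfolding E_def by blast
      ultimately show ?thesis
        by (simp add: algebra_simps)
    qed
    then show "\<exists>T B. open T \<and> t \<in> T \<and> (\<forall>s\<in>E \<inter> T. norm (z s - z t) \<le> B * norm (s - t))"
      using Bd(1) by (intro exI[of _ "ball t d"] exI[of _ "B + e"])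
        (auto simp: dist_real_def abs_minus_commute)
  qed
  moreover have "\<not> negligible {z q<..<z p}"
    using zq negligible_interval(2)[of "z q" "z p"] by (simp add: box_real)
  ultimately have "\<not> {z q<..<z p} \<subseteq> z ` E"
    using negligible_subset by blast
  then obtain v where v: "z q < v" "v < z p" "v \<notin> z ` E"
    by (meson greaterThanLessThan_iff subsetI)
  define Z where "Z = {t \<in> {p..q}. z t = v}"
  have "\<exists>t\<ge>p. t \<le> q \<and> z t = v"
    using IVT2'[of z q v p] v pq zcont by auto
  then have "Z \<noteq> {}"
    by (auto simp: Z_def)
  moreover have "compact Z"
    unfolding Z_def compact_eq_bounded_closed
    using continuous_closed_preimage_constant[OF zcont]
    by (auto intro: bounded_subset[of "{p..q}"])
  ultimately obtain t where t: "t \<in> Z" and last: "\<And>s. s \<in> Z \<Longrightarrow> s \<le> t"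
    using compact_attains_sup[of Z] by blast
  have tpq: "t \<in> {p<..<q} - N"
    using t v unfolding Z_def E_def by (auto simp: less_le)
  then obtain d where d: "0 \<le> d" "(y has_real_derivative d) (at t within {p..q})"
    using der by blast
  have "(z has_real_derivative (d + e)) (at t within {p..q})"
    unfolding z_def using d(2) by (auto intro!: derivative_eq_intros)
  \<comment> \<open>Right after \<open>t\<close> the function \<open>z\<close> exceeds
    \<open>v\<close>, but at \<open>q\<close> it is below \<open>v\<close>, so the value
    \<open>v\<close> is taken again later.\<close>
  then obtain r where r: "0 < r" "\<And>k. 0 < k \<Longrightarrow> t + k \<in> {p..q} \<Longrightarrow> k < r \<Longrightarrow> z t < z (t + k)"
    using has_real_derivative_pos_inc_right[of z "d + e" t "{p..q}"] d(1) e by auto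
  define s where "s = t + min (r / 2) (q - t)"
  have s: "t < s" "s \<le> q" "p \<le> s"
    using r(1) tpq by (auto simp: s_def)
  have "v < z s"
    using r(2)[of "s - t"] s t tpq r(1) by (auto simp: s_def Z_def min_def split: if_splits)
  moreover have "continuous_on {s..q} z"
    using zcont s by (auto intro: continuous_on_subset)
  ultimately obtain s' where "s \<le> s'" "s' \<le> q" "z s' = v"
    using IVT2'[of z q v s] v s by auto
  then have "s' \<in> Z"
    using s by (simp add: Z_def)
  with last \<open>s \<le> s'\<close> s(1) show False
    by force
qed

text \<open>Differentiability at one point only compares values with the one at that point. The
  constant is a bound for the derivative plus 1, the latter from the remainder estimate with
  tolerance 1. It serves both for functions along a curve and for class kappa functions at
  0.\<close>

lemma differentiable_imp_pointwise_lipschitz: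
  fixes V :: "'a::real_normed_vector \<Rightarrow> 'b::real_normed_vector"
  assumes "V differentiable (at p)"
  obtains B d where "0 < d" "0 \<le> B"
    "\<And>p'. norm (p' - p) < d \<Longrightarrow> norm (V p' - V p) \<le> B * norm (p' - p)"
proof -
  obtain V' where V': "(V has_derivative V') (at p)"
    using assms by (auto simp: differentiable_def)
  then have "bounded_linear V'"
    by (rule has_derivative_bounded_linear)
  then obtain K where K: "0 \<le> K" "\<And>w. norm (V' w) \<le> norm w * K"
    using bounded_linear.nonneg_bounded by blast
  obtain d where d: "0 < d"
    "\<And>p'. norm (p' - p) < d \<Longrightarrow> norm (V p' - V p - V' (p' - p)) \<le> 1 * norm (p' - p)"
    using V' unfolding has_derivative_at_alt by (meson zero_less_one)
  show thesis
  proof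
    fix p' assume "norm (p' - p) < d"
    then show "norm (V p' - V p) \<le> (K + 1) * norm (p' - p)"
      using d(2)[of p'] K(2)[of "p' - p"]
        norm_triangle_ineq[of "V p' - V p - V' (p' - p)" "V' (p' - p)"]
      by (simp add: algebra_simps)
  qed (use d K in auto)
qed

lemma continuous_on_along_curve:
  fixes V :: "('a::euclidean_space) \<times> real \<Rightarrow> real"
  assumes lip: "L-lipschitz_on {p..q} x"
    and diff: "\<And>t. t \<in> {p..q} \<Longrightarrow> V differentiable (at (x t, t))"
  shows "continuous_on {p..q} (\<lambda>t. V (x t, t))"
proof -
  have "continuous_on {p..q} x"
    using lip by (rule lipschitz_on_continuous_on)
  then have curve: "continuous_on {p..q} (\<lambda>t. (x t, t))"
    by (intro continuous_intros)
  have "continuous_on ((\<lambda>t. (x t, t)) ` {p..q}) V"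
    using diff by (auto intro!: continuous_at_imp_continuous_on differentiable_imp_continuous_within)
  with curve show ?thesis
    using continuous_on_compose[of "{p..q}" "\<lambda>t. (x t, t)" V] by (simp add: o_def)
qed

text \<open>Off \<open>N\<close> the chain rule gives the time derivative. At times in
  \<open>N\<close> the curve may have no velocity, yet its Lipschitz bound composed with the
  pointwise bound for \<open>V\<close> still controls the increments, which makes the real-variable
  criterion applicable.\<close>

lemma le_along_curve:
  fixes V :: "('a::euclidean_space) \<times> real \<Rightarrow> real"
  assumes "p \<le> q" and lip: "L-lipschitz_on {p..q} x" and "negligible N"
    and diff: "\<And>t. t \<in> {p..q} \<Longrightarrow> V differentiable (at (x t, t))"
    and der: "\<And>t. t \<in> {p<..<q} - N \<Longrightarrow>
      \<exists>v. (x has_vector_derivative v) (at t within {p..q}) \<and>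
        0 \<le> frechet_derivative V (at (x t, t)) (v, 1)"
  shows "V (x p, p) \<le> V (x q, q)"
proof (rule ae_deriv_nonneg_imp_le[of p q "\<lambda>t. V (x t, t)", OF \<open>p \<le> q\<close> _ \<open>negligible N\<close>])
  show "continuous_on {p..q} (\<lambda>t. V (x t, t))"
    using lip diff by (rule continuous_on_along_curve)
next
  fix t assume t: "t \<in> {p..q}"
  obtain B d where Bd: "0 < d" "0 \<le> B"
    "\<And>p'. norm (p' - (x t, t)) < d \<Longrightarrow> norm (V p' - V (x t, t)) \<le> B * norm (p' - (x t, t))"
    using differentiable_imp_pointwise_lipschitz[OF diff[OF t]] by metis
  have L: "0 \<le> L"
    using lip by (rule lipschitz_on_nonneg)
  have step: "norm ((x s, s) - (x t, t)) \<le> (L + 1) * \<bar>s - t\<bar>" if "s \<in> {p..q}" for s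
  proof -
    have "norm (x s - x t) \<le> L * \<bar>s - t\<bar>"
      using lipschitz_onD[OF lip that t] by (simp add: dist_norm)
    then show ?thesis
      using norm_Pair_le[of "x s - x t" "s - t"] by (simp add: algebra_simps)
  qed
  show "\<exists>B d. 0 < d \<and> (\<forall>s\<in>{p..q}. \<bar>s - t\<bar> < d \<longrightarrow>
      \<bar>V (x s, s) - V (x t, t)\<bar> \<le> B * \<bar>s - t\<bar>)"
  proof (intro exI conjI ballI impI)
    \<comment> \<open>The pair of state and time moves at speed at most \<open>L + 1\<close>, so it
      stays within distance \<open>d\<close> for this long.\<close>
    show "0 < d / (L + 1)"
      using Bd L by simp
    fix s assume s: "s \<in> {p..q}" and "\<bar>s - t\<bar> < d / (L + 1)"
    then have "(L + 1) * \<bar>s - t\<bar> < d"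
      using L by (simp add: field_simps)
    then have "\<bar>V (x s, s) - V (x t, t)\<bar> \<le> B * norm ((x s, s) - (x t, t))"
      using Bd(3)[of "(x s, s)"] step[OF s] by simp
    also have "\<dots> \<le> B * (L + 1) * \<bar>s - t\<bar>"
      using step[OF s] Bd(2) by (simp add: mult_left_mono mult.assoc)
    finally show "\<bar>V (x s, s) - V (x t, t)\<bar> \<le> B * (L + 1) * \<bar>s - t\<bar>" .
  qed
next
  fix t assume t: "t \<in> {p<..<q} - N"
  obtain v where v: "(x has_vector_derivative v) (at t within {p..q})"
    "0 \<le> frechet_derivative V (at (x t, t)) (v, 1)"
    using der[OF t] by blast
  let ?V' = "frechet_derivative V (at (x t, t))"
  have V': "(V has_derivative ?V') (at (x t, t))"
    using diff[of t] t by (simp add: frechet_derivative_works)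
  have "((\<lambda>t. (x t, t)) has_derivative (\<lambda>r. (r *\<^sub>R v, r))) (at t within {p..q})"
    using v(1) unfolding has_vector_derivative_def by (auto intro!: derivative_eq_intros)
  from has_derivative_compose[OF this V']
  have "((\<lambda>t. V (x t, t)) has_derivative (\<lambda>r. ?V' (r *\<^sub>R v, r))) (at t within {p..q})" .
  moreover have "?V' (r *\<^sub>R v, r) = ?V' (v, 1) * r" for r
    using linear_scale[OF has_derivative_linear[OF V'], of r "(v, 1)"] by simp
  ultimately have "((\<lambda>t. V (x t, t)) has_real_derivative ?V' (v, 1)) (at t within {p..q})"
    by (simp add: has_field_derivative_def)
  with v(2) show "\<exists>d\<ge>0. ((\<lambda>t. V (x t, t)) has_real_derivative d) (at t within {p..q})"
    by blast
qed

text \<open>The cutoff at \<open>- \<delta>\<close> matters: the differential inequality is available only near the zero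
  level, because the extension of a class kappa function to negative arguments is arbitrary.\<close>

lemma nonneg_along_curve:
  fixes V :: "('a::euclidean_space) \<times> real \<Rightarrow> real"
  assumes "p \<le> q" and lip: "L-lipschitz_on {p..q} x" and "negligible N"
    and diff: "\<And>t. t \<in> {p..q} \<Longrightarrow> V differentiable (at (x t, t))"
    and init: "0 \<le> V (x p, p)" and "0 < \<delta>"
    and der: "\<And>t. t \<in> {p<..<q} - N \<Longrightarrow> - \<delta> < V (x t, t) \<Longrightarrow> V (x t, t) < 0 \<Longrightarrow>
      \<exists>v. (x has_vector_derivative v) (at t within {p..q}) \<and>
        K * V (x t, t) \<le> frechet_derivative V (at (x t, t)) (v, 1)"
  shows "0 \<le> V (x q, q)"
proof (rule ccontr)
  assume neg: "\<not> 0 \<le> V (x q, q)"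
  define y where "y t = V (x t, t)" for t
  have ycont: "continuous_on {p..q} y"
    unfolding y_def using lip diff by (rule continuous_on_along_curve)
  \<comment> \<open>The last time \<open>t0\<close> with a nonnegative value starts the excursion
    below zero that ends at \<open>q\<close>.\<close>
  define S where "S = {p..q} \<inter> y -` {0..}"
  have "closed S"
    unfolding S_def using ycont by (rule continuous_closed_preimage) auto
  then have "compact S"
    using compact_Int_closed[of "{p..q}" S] by (simp add: S_def Int_absorb1)
  moreover have "p \<in> S"
    using init \<open>p \<le> q\<close> by (simp add: S_def y_def)
  ultimately obtain t0 where t0: "t0 \<in> S" and last: "\<And>s. s \<in> S \<Longrightarrow> s \<le> t0"
    using compact_attains_sup[of S] by blast
  have t0q: "p \<le> t0" "t0 < q" "0 \<le> y t0"
    using t0 neg by (auto simp: S_def y_def less_le)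
  obtain e where e: "0 < e" "\<And>s. s \<in> {p..q} \<Longrightarrow> dist s t0 < e \<Longrightarrow> dist (y s) (y t0) < \<delta>"
    using ycont[unfolded continuous_on_iff, rule_format, of t0 \<delta>] t0q \<open>0 < \<delta>\<close> that
    by (meson atLeastAtMost_iff less_imp_le)
  \<comment> \<open>By continuity the values stay above \<open>- \<delta>\<close> for a while after
    \<open>t0\<close>, so up to \<open>t1\<close> they lie in the band for which \<open>der\<close>
    is stated.\<close>
  define t1 where "t1 = min (t0 + e / 2) q"
  have t1: "t0 < t1" "t1 \<le> q" "t1 < t0 + e"
    using e(1) t0q by (auto simp: t1_def)
  have near: "- \<delta> < y s \<and> y s < 0" if "s \<in> {t0<..t1}" for s
  proof
    show "- \<delta> < y s"
      using e(2)[of s] that t0q t1 by (auto simp: dist_real_def)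
    show "y s < 0"
      using last[of s] that t0q t1 by (force simp: S_def)
  qed
  have sub: "{t0..t1} \<subseteq> {p..q}"
    using t0q t1 by auto
  \<comment> \<open>Integrating factor: \<open>V' \<ge> K * V\<close> makes
    \<open>exp (- K * t) * V\<close> nondecreasing along the curve, so it cannot pass from a
    nonnegative value at \<open>t0\<close> to a negative one at \<open>t1\<close>.\<close>
  define W where "W p = exp (- K * snd p) * V p" for p
  have W': "(W has_derivative (\<lambda>w. exp (- K * t) *
      (frechet_derivative V (at (x t, t)) w - K * snd w * V (x t, t)))) (at (x t, t))"
    if "t \<in> {t0..t1}" for t
  proof -
    have "(V has_derivative frechet_derivative V (at (x t, t))) (at (x t, t))"
      using diff[of t] that sub by (auto simp: frechet_derivative_works)
    then show ?thesis
      unfolding W_def by (auto intro!: derivative_eq_intros simp: algebra_simps)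
  qed
  have "W (x t0, t0) \<le> W (x t1, t1)"
  proof (rule le_along_curve[OF _ _ \<open>negligible N\<close>])
    show "t0 \<le> t1"
      using t1 by simp
    show "L-lipschitz_on {t0..t1} x"
      using lip sub by (rule lipschitz_on_subset)
    show "W differentiable (at (x t, t))" if "t \<in> {t0..t1}" for t
      using W'[OF that] by (auto simp: differentiable_def)
    fix t assume t: "t \<in> {t0<..<t1} - N"
    then have "- \<delta> < V (x t, t)" "V (x t, t) < 0"
      using near[of t] by (auto simp: y_def)
    then obtain v where v: "(x has_vector_derivative v) (at t within {p..q})"
      "K * V (x t, t) \<le> frechet_derivative V (at (x t, t)) (v, 1)"
      using der[of t] t t0q t1 by force
    have "frechet_derivative W (at (x t, t)) (v, 1) =
        exp (- K * t) * (frechet_derivative V (at (x t, t)) (v, 1) - K * V (x t, t))"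
      using frechet_derivative_at[OF W'[of t], symmetric] t by simp
    then have "0 \<le> frechet_derivative W (at (x t, t)) (v, 1)"
      using v(2) by simp
    moreover have "(x has_vector_derivative v) (at t within {t0..t1})"
      using v(1) sub by (rule has_vector_derivative_within_subset)
    ultimately show "\<exists>v. (x has_vector_derivative v) (at t within {t0..t1}) \<and>
        0 \<le> frechet_derivative W (at (x t, t)) (v, 1)"
      by blast
  qed
  moreover have "0 \<le> W (x t0, t0)"
    using t0q by (simp add: W_def y_def)
  moreover have "W (x t1, t1) < 0"
    using near[of t1] t1 by (simp add: W_def y_def mult_pos_neg)
  ultimately show False
    by simp
qed

subsection \<open>Regularity along a flow\<close>

text \<open>This class is closed under products and composition, hence contains not only \<open>b\<close> but every
  \<open>\<psi>\<^sub>i\<close>.  In the application \<open>F\<close> is the drift and \<open>W p\<close> the set of control directions.\<close>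

primrec flow_regular ::
  "('a::real_normed_vector \<Rightarrow> 'a) \<Rightarrow> ('a \<Rightarrow> 'a set) \<Rightarrow> 'a set \<Rightarrow> nat \<Rightarrow> ('a \<Rightarrow> real) \<Rightarrow> bool" where
  "flow_regular F W D 0 \<phi> \<longleftrightarrow> True"
| "flow_regular F W D (Suc k) \<phi> \<longleftrightarrow>
     (\<forall>p\<in>D. \<phi> differentiable (at p)) \<and>
     (0 < k \<longrightarrow> (\<forall>p\<in>D. \<forall>w\<in>W p. frechet_derivative \<phi> (at p) w = 0)) \<and>
     flow_regular F W D k (\<lambda>p. frechet_derivative \<phi> (at p) (F p))"

lemma flow_regular_cong:
  assumes "open D" "\<And>p. p \<in> D \<Longrightarrow> \<phi> p = \<eta> p" "flow_regular F W D k \<phi>"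
  shows "flow_regular F W D k \<eta>"
  using assms(2,3)
proof (induction k arbitrary: \<phi> \<eta>)
  case (Suc k)
  have eq: "frechet_derivative \<phi> (at p) = frechet_derivative \<eta> (at p)" if "p \<in> D" for p
    using Suc.prems that \<open>open D\<close> by (intro frechet_derivative_transform_within_open[of _ _ D]) auto
  have "\<eta> differentiable (at p)" if "p \<in> D" for p
    using Suc.prems that \<open>open D\<close> unfolding differentiable_def flow_regular.simps
    by (metis has_derivative_transform_within_open)
  then show ?case
    using Suc.prems(2) eq
      Suc.IH[of "\<lambda>p. frechet_derivative \<phi> (at p) (F p)" "\<lambda>p. frechet_derivative \<eta> (at p) (F p)"]
    by auto
qed simp

lemma flow_regular_SucD: "flow_regular F W D (Suc k) \<phi> \<Longrightarrow> flow_regular F W D k \<phi>"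
  by (induction k arbitrary: \<phi>) auto

text \<open>Lets the closure proofs supply the derivative given by the sum, product or chain rule in
  place of \<open>frechet_derivative\<close>; on the open set \<open>D\<close> the two
  agree.\<close>

lemma flow_regular_SucI:
  assumes "open D" "\<And>p. p \<in> D \<Longrightarrow> (\<phi> has_derivative \<phi>' p) (at p)"
    and "\<And>p w. 0 < k \<Longrightarrow> p \<in> D \<Longrightarrow> w \<in> W p \<Longrightarrow> \<phi>' p w = 0"
    and "flow_regular F W D k (\<lambda>p. \<phi>' p (F p))"
  shows "flow_regular F W D (Suc k) \<phi>"
proof -
  have eq: "\<phi>' p = frechet_derivative \<phi> (at p)" if "p \<in> D" for p
    using assms(2)[OF that] by (rule frechet_derivative_at)
  have "flow_regular F W D k (\<lambda>p. frechet_derivative \<phi> (at p) (F p))"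
    using eq by (intro flow_regular_cong[OF assms(1) _ assms(4)]) simp
  then show ?thesis
    using assms(2,3) eq by (auto simp: differentiable_def)
qed

lemma flow_regular_derivD:
  assumes "flow_regular F W D (Suc k) \<phi>"
  shows "p \<in> D \<Longrightarrow> (\<phi> has_derivative frechet_derivative \<phi> (at p)) (at p)"
    and "0 < k \<Longrightarrow> p \<in> D \<Longrightarrow> w \<in> W p \<Longrightarrow> frechet_derivative \<phi> (at p) w = 0"
    and "flow_regular F W D k (\<lambda>p. frechet_derivative \<phi> (at p) (F p))"
  using assms by (auto simp: frechet_derivative_works)

lemma flow_regular_add:
  assumes "open D" "flow_regular F W D k \<phi>" "flow_regular F W D k \<eta>"
  shows "flow_regular F W D k (\<lambda>p. \<phi> p + \<eta> p)"
  using assms(2,3)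
proof (induction k arbitrary: \<phi> \<eta>)
  case (Suc k)
  let ?\<phi>' = "\<lambda>p. frechet_derivative \<phi> (at p)"
  note \<phi>' = flow_regular_derivD[OF Suc.prems(1)]
  let ?\<eta>' = "\<lambda>p. frechet_derivative \<eta> (at p)"
  note \<eta>' = flow_regular_derivD[OF Suc.prems(2)]
  show ?case
    by (rule flow_regular_SucI[OF \<open>open D\<close>, where \<phi>' = "\<lambda>p w. ?\<phi>' p w + ?\<eta>' p w"])
      (auto intro!: has_derivative_add Suc.IH \<phi>' \<eta>' simp: \<phi>'(2) \<eta>'(2))
qed simp

text \<open>The product rule yields products of a factor with the derivative of the other; both have
  order \<open>k\<close> once the undifferentiated factor is lowered by one order.\<close>

lemma flow_regular_mult:
  assumes "open D" "flow_regular F W D k \<phi>" "flow_regular F W D k \<eta>"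
  shows "flow_regular F W D k (\<lambda>p. \<phi> p * \<eta> p)"
  using assms(2,3)
proof (induction k arbitrary: \<phi> \<eta>)
  case (Suc k)
  let ?\<phi>' = "\<lambda>p. frechet_derivative \<phi> (at p)"
  note \<phi>' = flow_regular_derivD[OF Suc.prems(1)]
  let ?\<eta>' = "\<lambda>p. frechet_derivative \<eta> (at p)"
  note \<eta>' = flow_regular_derivD[OF Suc.prems(2)]
  note lower = Suc.prems[THEN flow_regular_SucD]
  show ?case
    by (rule flow_regular_SucI[OF \<open>open D\<close>, where \<phi>' = "\<lambda>p w. \<phi> p * ?\<eta>' p w + ?\<phi>' p w * \<eta> p"])
      (auto intro!: has_derivative_mult flow_regular_add \<open>open D\<close> Suc.IH lower \<phi>' \<eta>'
         simp: \<phi>'(2) \<eta>'(2))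
qed simp

text \<open>The chain rule leaves the product of \<open>deriv \<alpha> (\<phi> p)\<close> with the
  flow derivative of \<open>\<phi>\<close>, so the induction passes from \<open>\<alpha>\<close> to
  \<open>deriv \<alpha>\<close> and lowers the order of \<open>\<phi>\<close>.\<close>

lemma flow_regular_compose:
  assumes "open D" "flow_regular F W D k \<phi>" "times_differentiable_on k S \<alpha>"
    and S: "\<And>p. p \<in> D \<Longrightarrow> \<phi> p \<in> S"
  shows "flow_regular F W D k (\<lambda>p. \<alpha> (\<phi> p))"
  using assms(2,3)
proof (induction k arbitrary: \<alpha>)
  case (Suc k)
  let ?\<phi>' = "\<lambda>p. frechet_derivative \<phi> (at p)"
  note \<phi>' = flow_regular_derivD[OF Suc.prems(1)]
  have "\<alpha> differentiable (at r)" if "r \<in> S" for r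
    using Suc.prems(2) that unfolding times_differentiable_on_def by (metis funpow_0 zero_less_Suc)
  then have "(\<alpha> has_real_derivative deriv \<alpha> r) (at r)" if "r \<in> S" for r
    using that DERIV_deriv_iff_real_differentiable by blast
  then have \<alpha>': "((\<lambda>p. \<alpha> (\<phi> p)) has_derivative (\<lambda>w. deriv \<alpha> (\<phi> p) * ?\<phi>' p w)) (at p)"
    if "p \<in> D" for p
    using has_derivative_compose[OF \<phi>'(1)[OF that]] S[OF that]
    by (fastforce simp: has_field_derivative_def)
  have "times_differentiable_on k S (deriv \<alpha>)"
    unfolding times_differentiable_on_def
  proof (intro allI impI ballI)
    fix i r assume "i < k" "r \<in> S"
    then have "(deriv ^^ Suc i) \<alpha> differentiable (at r)"
      using Suc.prems(2) unfolding times_differentiable_on_def by blast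
    then show "(deriv ^^ i) (deriv \<alpha>) differentiable (at r)"
      by (simp only: funpow_Suc_right o_apply)
  qed
  then have "flow_regular F W D k (\<lambda>p. deriv \<alpha> (\<phi> p))"
    using Suc.IH flow_regular_SucD[OF Suc.prems(1)] by blast
  then have "flow_regular F W D k (\<lambda>p. deriv \<alpha> (\<phi> p) * ?\<phi>' p (F p))"
    using \<phi>'(3) by (rule flow_regular_mult[OF \<open>open D\<close>])
  then show ?case
    by (rule flow_regular_SucI[OF \<open>open D\<close> \<alpha>', rotated 2]) (auto simp: \<phi>'(2))
qed simp

text \<open>Time is treated as an extra state of unit speed on which the control does not
  act.\<close>

abbreviation drift_field :: "(real^'n \<Rightarrow> real^'n) \<Rightarrow> (real^'n) \<times> real \<Rightarrow> (real^'n) \<times> real" where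
  "drift_field f p \<equiv> (f (fst p), 1)"

abbreviation control_directions ::
  "(real^'n \<Rightarrow> real^'q^'n) \<Rightarrow> (real^'n) \<times> real \<Rightarrow> ((real^'n) \<times> real) set" where
  "control_directions g p \<equiv> range (\<lambda>u. (g (fst p) *v u, 0))"

text \<open>Each differentiation uses up one order. The guard \<open>0 < k\<close> in
  \<open>flow_regular\<close> matches the bound \<open>k < m - 1\<close> in
  \<open>relative_degree\<close>: the control may appear only in the last differentiation.\<close>

lemma flow_regular_drift_deriv:
  assumes "relative_degree f g D b m" "k \<le> m"
  shows "flow_regular (drift_field f) (control_directions g) D k (drift_deriv f b (m - k))"
  using assms(2)
proof (induction k)
  case (Suc k)
  have "flow_regular (drift_field f) (control_directions g) D k (drift_deriv f b (m - k))"
    using Suc by simp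
  moreover have "m - k = Suc (m - Suc k)"
    using Suc.prems by simp
  moreover have "\<forall>p\<in>D. drift_deriv f b (m - Suc k) differentiable (at p)"
    using assms(1) Suc.prems unfolding relative_degree_def by simp
  moreover have "0 < k \<longrightarrow> m - Suc k < m - 1"
    using Suc.prems by linarith
  ultimately show ?case
    using assms(1) unfolding relative_degree_def by auto
qed simp

text \<open>Both summands of the next function lose exactly one order: the flow derivative by
  definition, the class kappa term because \<open>\<alpha> i\<close> is \<open>m - i\<close> times
  differentiable. Hence every function below index \<open>m\<close> is differentiable, and the
  control stays invisible before the last step.\<close>

lemma flow_regular_psi:
  assumes "hocbf f g U T D b m a \<alpha>" "i \<le> m"
  shows "flow_regular (drift_field f) (control_directions g) D (m - i) (psi f b \<alpha> i)"
  using assms(2)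
proof (induction i)
  case 0
  show ?case
    using flow_regular_drift_deriv[of f g D b m m] assms(1) by (simp add: hocbf_def)
next
  case (Suc i)
  have "open D"
    using assms(1) by (simp add: hocbf_def)
  have "Suc i \<in> {1..m}"
    using Suc.prems by simp
  then have "times_differentiable_on (m - Suc i) {r. ereal r < a (Suc i)} (\<alpha> (Suc i))"
    and "\<forall>p\<in>D. ereal (psi f b \<alpha> (Suc i - 1) p) < a (Suc i)"
    using assms(1) unfolding hocbf_def by blast+
  moreover have IH: "flow_regular (drift_field f) (control_directions g) D (Suc (m - Suc i))
      (psi f b \<alpha> i)"
    using Suc by (simp add: Suc_diff_Suc)
  ultimately have "flow_regular (drift_field f) (control_directions g) D (m - Suc i)
      (\<lambda>p. \<alpha> (Suc i) (psi f b \<alpha> i p))"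
    by (intro flow_regular_compose[OF \<open>open D\<close> flow_regular_SucD[OF IH]]) auto
  then show ?case
    using flow_regular_add[OF \<open>open D\<close> flow_regular_derivD(3)[OF IH]] by simp
qed

subsection \<open>Forward invariance\<close>

lemma psi_nonneg_step:
  assumes hocbf: "hocbf f g U T D b m a \<alpha>" and traj: "trajectory f g U T x0 u x"
    and \<tau>: "0 \<le> \<tau>" "\<tau> \<le> T" and i: "i < m" and init: "0 \<le> psi f b \<alpha> i (x0, 0)"
    and dom: "\<And>t. t \<in> {0..\<tau>} \<Longrightarrow> (x t, t) \<in> D"
    and succ: "\<And>t. t \<in> {0..\<tau>} \<Longrightarrow> 0 \<le> (if Suc i = m then psi_top f g b \<alpha> m (x t, t) (u t)
        else psi f b \<alpha> (Suc i) (x t, t))"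
  shows "0 \<le> psi f b \<alpha> i (x \<tau>, \<tau>)"
proof -
  let ?V = "psi f b \<alpha> i"
  obtain L N where L: "L-lipschitz_on {0..T} x" and "negligible N"
    and sol: "\<And>t. t \<in> {0..T} - N \<Longrightarrow>
      (x has_vector_derivative (f (x t) + g (x t) *v u t)) (at t within {0..T})"
    using traj unfolding trajectory_def by blast
  have reg: "flow_regular (drift_field f) (control_directions g) D (Suc (m - Suc i)) ?V"
    using flow_regular_psi[OF hocbf, of i] i by (simp add: Suc_diff_Suc)
  have V': "(?V has_derivative frechet_derivative ?V (at p)) (at p)" if "p \<in> D" for p
    using reg that by (auto simp: frechet_derivative_works)
  \<comment> \<open>Nonnegativity of the successor, read as a bound on the derivative along the
    solution. Below the top index the control term vanishes by regularity, so both cases take the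
    same form.\<close>
  have lower: "- \<alpha> (Suc i) (?V (x t, t)) \<le>
      frechet_derivative ?V (at (x t, t)) (f (x t) + g (x t) *v u t, 1)" if t: "t \<in> {0..\<tau>}" for t
  proof (cases "Suc i = m")
    case True
    then show ?thesis
      using succ[OF t] by (auto simp: psi_top_def)
  next
    case False
    have "frechet_derivative ?V (at (x t, t)) (f (x t) + g (x t) *v u t, 1) =
        frechet_derivative ?V (at (x t, t)) ((f (x t), 1) + (g (x t) *v u t, 0))"
      by simp
    also have "\<dots> = frechet_derivative ?V (at (x t, t)) (f (x t), 1) +
        frechet_derivative ?V (at (x t, t)) (g (x t) *v u t, 0)"
      by (rule linear_add[OF has_derivative_linear[OF V'[OF dom[OF t]]]])
    also have "frechet_derivative ?V (at (x t, t)) (g (x t) *v u t, 0) = 0"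
      using reg False i dom[OF t] by force
    finally show ?thesis
      using succ[OF t] False by simp
  qed
  \<comment> \<open>A linear bound just below zero. At the top index the sign of the extension gives
    \<open>K = 0\<close>; otherwise at least one derivative is prescribed, so
    \<open>\<alpha>\<close> is differentiable at its zero 0 and hence Lipschitz there.\<close>
  have "\<exists>K \<delta>. 0 < \<delta> \<and> (\<forall>r. - \<delta> < r \<longrightarrow> r < 0 \<longrightarrow> K * r \<le> - \<alpha> (Suc i) r)"
  proof (cases "Suc i = m")
    case True
    then have "\<forall>r<0. \<alpha> (Suc i) r \<le> 0"
      using hocbf unfolding hocbf_def by blast
    then show ?thesis
      by (intro exI[of _ 0] exI[of _ 1]) auto
  next
    case False
    then have "Suc i \<in> {1..m}" "0 < m - Suc i"
      using i by auto
    then have \<alpha>0: "\<alpha> (Suc i) 0 = 0" and diff0: "\<alpha> (Suc i) differentiable (at 0)"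
      using hocbf unfolding hocbf_def class_kappa_def times_differentiable_on_def zero_ereal_def
      by fastforce+
    obtain B d where Bd: "0 < d" "0 \<le> B"
      "\<And>r. norm (r - 0) < d \<Longrightarrow> norm (\<alpha> (Suc i) r - \<alpha> (Suc i) 0) \<le> B * norm (r - 0)"
      using differentiable_imp_pointwise_lipschitz[OF diff0] by metis
    have "B * r \<le> - \<alpha> (Suc i) r" if "- d < r" "r < 0" for r
      using Bd(3)[of r] \<alpha>0 that by auto
    with Bd(1) show ?thesis
      by blast
  qed
  then obtain K \<delta> where \<delta>: "0 < \<delta>"
    and K: "\<And>r. - \<delta> < r \<Longrightarrow> r < 0 \<Longrightarrow> K * r \<le> - \<alpha> (Suc i) r"
    by blast
  have sub: "{0..\<tau>} \<subseteq> {0..T}"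
    using \<tau> by auto
  show ?thesis
  proof (rule nonneg_along_curve[OF \<tau>(1) lipschitz_on_subset[OF L sub] \<open>negligible N\<close> _ _ \<delta>])
    show "?V differentiable (at (x t, t))" if "t \<in> {0..\<tau>}" for t
      using V'[OF dom[OF that]] by (auto simp: differentiable_def)
    show "0 \<le> ?V (x 0, 0)"
      using init traj by (simp add: trajectory_def)
    fix t assume t: "t \<in> {0<..<\<tau>} - N" and V: "- \<delta> < ?V (x t, t)" "?V (x t, t) < 0"
    have "(x has_vector_derivative (f (x t) + g (x t) *v u t)) (at t within {0..\<tau>})"
      using sol[of t] t sub by (auto intro: has_vector_derivative_within_subset)
    moreover have "K * ?V (x t, t) \<le>
        frechet_derivative ?V (at (x t, t)) (f (x t) + g (x t) *v u t, 1)"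
      using K[OF V] lower[of t] t by simp
    ultimately show "\<exists>v. (x has_vector_derivative v) (at t within {0..\<tau>}) \<and>
        K * ?V (x t, t) \<le> frechet_derivative ?V (at (x t, t)) (v, 1)"
      by blast
  qed
qed

lemma hocbf_invariant:
  assumes hocbf: "hocbf f g U T D b m a \<alpha>" and traj: "trajectory f g U T x0 u x"
    and init: "\<And>i. i < m \<Longrightarrow> 0 \<le> psi f b \<alpha> i (x0, 0)"
    and "\<tau> \<le> T"
    and con: "\<And>t. t \<in> {0..\<tau>} \<Longrightarrow> (x t, t) \<in> D \<and> 0 \<le> psi_top f g b \<alpha> m (x t, t) (u t)"
    and "i < m" "t \<in> {0..\<tau>}"
  shows "0 \<le> psi f b \<alpha> i (x t, t)"
proof -
  \<comment> \<open>Induction downwards from index \<open>m - 1\<close>, where the control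
    constraint drives the step. The time is kept general because each step needs the next function
    to be nonnegative at all earlier times.\<close>
  have "n < m \<Longrightarrow> t \<in> {0..\<tau>} \<Longrightarrow> 0 \<le> psi f b \<alpha> (m - Suc n) (x t, t)" for n t
  proof (induction n arbitrary: t)
    case 0
    then show ?case
      using \<open>\<tau> \<le> T\<close> con by (intro psi_nonneg_step[OF hocbf traj _ _ _ init]) auto
  next
    case (Suc n)
    then have n: "Suc (m - Suc (Suc n)) = m - Suc n" "m - Suc n \<noteq> m" "n < m"
      by auto
    have IH: "0 \<le> psi f b \<alpha> (m - Suc n) (x s, s)" if "s \<in> {0..t}" for s
      using Suc.prems that by (intro Suc.IH n) auto
    show ?case
    proof (rule psi_nonneg_step[OF hocbf traj])
      show "0 \<le> psi f b \<alpha> (m - Suc (Suc n)) (x0, 0)"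
        using Suc.prems by (intro init) simp
      show "(x s, s) \<in> D" if "s \<in> {0..t}" for s
        using con[of s] Suc.prems that by simp
      show "0 \<le> (if Suc (m - Suc (Suc n)) = m then psi_top f g b \<alpha> m (x s, s) (u s)
          else psi f b \<alpha> (Suc (m - Suc (Suc n))) (x s, s))" if "s \<in> {0..t}" for s
        using IH[OF that] n by (simp only: if_False)
    qed (use Suc.prems \<open>\<tau> \<le> T\<close> in auto)
  qed
  from this[of "m - Suc i" t] show ?thesis
    using assms(6,7) by simp
qed

subsection \<open>Temporal formulas\<close>

lemma sat_state_negation_free:
  "state_negation_free \<theta> \<Longrightarrow> sat_state h y \<theta> \<longleftrightarrow> (\<forall>j\<in>set (state_atoms \<theta>). 0 \<le> h j y)"
  by (induction \<theta>) auto

lemma enclosing_neq_Conj: "enclosing \<phi> j \<noteq> Conj \<phi>1 \<phi>2"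
  by (induction \<phi>) auto

lemma enclosing_inherits:
  assumes "j \<in> set (atoms \<phi>)"
  shows "well_timed \<phi> \<Longrightarrow> well_timed (enclosing \<phi> j)"
    and "negation_free \<phi> \<Longrightarrow> negation_free (enclosing \<phi> j)"
    and "horizon (enclosing \<phi> j) \<le> horizon \<phi>"
    and "set (atoms (enclosing \<phi> j)) \<subseteq> set (atoms \<phi>)"
  using assms by (induction \<phi>) (auto simp: le_max_iff_disj)

text \<open>Needed for joint deletion: since indices are not repeated, all atoms of one temporal
  subformula are governed by the same deletion rule.\<close>

lemma enclosing_eq:
  assumes "distinct (atoms \<phi>)" "j \<in> set (atoms \<phi>)" "i \<in> set (atoms (enclosing \<phi> j))"
  shows "enclosing \<phi> i = enclosing \<phi> j"
  using assms
proof (induction \<phi>)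
  case (Conj \<phi>1 \<phi>2)
  then show ?case
    using enclosing_inherits(4)[of j \<phi>1] enclosing_inherits(4)[of j \<phi>2] by (auto split: if_splits)
qed auto

text \<open>Temporal subformulas without atoms are equivalent to \<open>STrue\<close>; no index \<open>j\<close> reaches them, and
  they hold because their intervals are nonempty.\<close>

lemma sat_if_sat_enclosing:
  assumes "well_timed \<phi>" "negation_free \<phi>" "distinct (atoms \<phi>)"
    and "\<And>j. j \<in> set (atoms \<phi>) \<Longrightarrow> sat h x (enclosing \<phi> j)"
  shows "sat h x \<phi>"
  using assms
proof (induction \<phi>)
  case (Eventually a b \<theta>)
  show ?case
  proof (cases "state_atoms \<theta>")
    case Nil
    then show ?thesis
      using Eventually.prems(1,2) by (auto simp: sat_state_negation_free)
  next
    case (Cons j js)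
    then show ?thesis
      using Eventually.prems(4)[of j] by simp
  qed
next
  case (Always a b \<theta>)
  show ?case
  proof (cases "state_atoms \<theta>")
    case Nil
    then show ?thesis
      using Always.prems(2) by (simp add: sat_state_negation_free)
  next
    case (Cons j js)
    then show ?thesis
      using Always.prems(4)[of j] by simp
  qed
next
  case (Conj \<phi>1 \<phi>2)
  have "sat h x (enclosing \<phi>2 j)" if "j \<in> set (atoms \<phi>2)" for j
    using Conj.prems(3) Conj.prems(4)[of j] that by (auto split: if_splits)
  moreover have "sat h x (enclosing \<phi>1 j)" if "j \<in> set (atoms \<phi>1)" for j
    using Conj.prems(4)[of j] that by auto
  ultimately show ?case
    using Conj.IH Conj.prems(1-3) by simp
qed

lemma gamma_nonpos_under_F:
  assumes "gamma_form h x0 \<phi> j \<gamma>" "enclosing \<phi> j = Eventually ta tb \<theta>"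
    and "cat_II h x0 \<phi> j \<Longrightarrow> cond_F (h j) x0 (t_start \<phi> j) (t_end \<phi> j) \<gamma>"
  shows "\<gamma> tb \<le> 0"
  using assms
  by (cases "cat_I h x0 \<phi> j")
    (auto simp: gamma_form_def cat_II_def under_F_def cond_F_def t_end_def)

text \<open>In Category III the decaying exponential keeps the shift below its value at
  \<open>ta\<close>, which (G) makes negative; in Category I the shift is zero.\<close>

lemma gamma_nonpos_under_G:
  assumes "gamma_form h x0 \<phi> j \<gamma>" "enclosing \<phi> j = Always ta tb \<theta>"
    and "cat_III h x0 \<phi> j \<Longrightarrow> cond_G (h j) x0 (t_start \<phi> j) \<gamma>" "ta \<le> t"
  shows "\<gamma> t \<le> 0"
proof (cases "cat_I h x0 \<phi> j")
  case True
  then show ?thesis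
    using assms(1) by (simp add: gamma_form_def)
next
  case False
  then have III: "cat_III h x0 \<phi> j"
    using assms(2) by (simp add: cat_III_def under_G_def)
  then obtain w1 w2 k where w: "0 < w1" "0 < w2" "\<And>t. \<gamma> t = w1 * exp (- w2 * t) - k"
    using assms(1) unfolding gamma_form_def by blast
  have "\<gamma> t \<le> \<gamma> ta"
    using w assms(4) by simp
  also have "\<gamma> ta < 0"
    using assms(2,3) III by (simp add: cond_G_def t_start_def)
  finally show ?thesis
    by simp
qed

theorem theorem4:
  fixes f :: "real^'n \<Rightarrow> real^'n"
    and g :: "real^'n \<Rightarrow> real^'q^'n"
    and u_min u_max :: "real^'q"
    and U :: "(real^'q) set"
    and X0 :: "(real^'n) set"
    and x0 :: "real^'n"
    and \<phi> :: stl
    and M :: nat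
    and T :: real
    and h :: "nat \<Rightarrow> real^'n \<Rightarrow> real"
    and \<sigma> :: "real^'o \<Rightarrow> real"
    and l :: "real^'n \<Rightarrow> real^'o"
    and s R :: "nat \<Rightarrow> real"
    and c :: "nat \<Rightarrow> real^'o"
    and \<gamma> :: "nat \<Rightarrow> real \<Rightarrow> real"
    and b :: "nat \<Rightarrow> (real^'n) \<times> real \<Rightarrow> real"
    and D :: "nat \<Rightarrow> ((real^'n) \<times> real) set"
    and m :: "nat \<Rightarrow> nat"
    and a :: "nat \<Rightarrow> nat \<Rightarrow> ereal"
    and \<alpha> :: "nat \<Rightarrow> nat \<Rightarrow> real \<Rightarrow> real"
    and u :: "real \<Rightarrow> real^'q"
    and x :: "real \<Rightarrow> real^'n"
  assumes "local_lipschitz (UNIV :: real set) UNIV (\<lambda>_. f)"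
    and "local_lipschitz (UNIV :: real set) UNIV (\<lambda>_. g)"
    and "U = cbox u_min u_max"
    and "x0 \<in> X0"
    and "well_timed \<phi>" and "negation_free \<phi>"
    and "distinct (atoms \<phi>)" and "set (atoms \<phi>) = {1..M}"
    and "\<And>j k. 1 \<le> j \<Longrightarrow> j \<le> k \<Longrightarrow> k \<le> M \<Longrightarrow> t_end \<phi> j \<le> t_end \<phi> k"
    and "T = horizon \<phi>"
    and "\<And>j. j \<in> {1..M} \<Longrightarrow> continuous_on UNIV (h j)"
    and A1: "\<And>\<xi>. \<xi> \<in> X0 \<Longrightarrow> \<exists>v y. trajectory f g U T \<xi> v y \<and> sat h y \<phi>"
    and A2: "strictly_convex_gauge \<sigma>" "\<And>y. l differentiable (at y)"
      "\<And>j. j \<in> {1..M} \<Longrightarrow> cat_II h x0 \<phi> j \<or> cat_III h x0 \<phi> j \<Longrightarrow>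
         gauge_shape \<sigma> l (s j) (R j) (c j) (h j)"
    and "\<And>j. j \<in> {1..M} \<Longrightarrow> gamma_form h x0 \<phi> j (\<gamma> j)"
    and "\<And>j y t. j \<in> {1..M} \<Longrightarrow> b j (y, t) = h j y + \<gamma> j t"
    and F: "\<And>j. j \<in> {1..M} \<Longrightarrow> cat_II h x0 \<phi> j \<Longrightarrow>
         cond_F (h j) x0 (t_start \<phi> j) (t_end \<phi> j) (\<gamma> j)"
    and G: "\<And>j. j \<in> {1..M} \<Longrightarrow> cat_III h x0 \<phi> j \<Longrightarrow> cond_G (h j) x0 (t_start \<phi> j) (\<gamma> j)"
    and N: "\<And>j k. 2 \<le> j \<Longrightarrow> j \<le> M \<Longrightarrow> 1 \<le> k \<Longrightarrow> k \<le> j - 1 \<Longrightarrow>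
         gauge_shape \<sigma> l (s j) (R j) (c j) (h j) \<Longrightarrow>
         gauge_shape \<sigma> l (s k) (R k) (c k) (h k) \<Longrightarrow>
         cond_N \<sigma> s R c \<gamma> (t_end \<phi> k) j k"
    and "\<And>j. j \<in> {1..M} \<Longrightarrow> hocbf f g U T (D j) (b j) (m j) (a j) (\<alpha> j)"
    and "\<And>j. j \<in> {1..M} \<Longrightarrow>
         (x0, 0) \<in> D j \<and> (\<forall>i<m j. 0 \<le> psi f (b j) (\<alpha> j) i (x0, 0))"
    and "trajectory f g U T x0 u x"
    and "\<And>j t. j \<in> {1..M} \<Longrightarrow> t \<in> {0..T} \<Longrightarrow> active h \<phi> x j t \<Longrightarrow>
         (x t, t) \<in> D j \<and> 0 \<le> psi_top f g (b j) (\<alpha> j) (m j) (x t, t) (u t)"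
  shows "sat h x \<phi>"
proof (rule sat_if_sat_enclosing)
  fix j assume j: "j \<in> set (atoms \<phi>)"
  note atoms = \<open>set (atoms \<phi>) = {1..M}\<close>
  have same: "i \<in> {1..M}" "enclosing \<phi> i = enclosing \<phi> j" if "i \<in> set (atoms (enclosing \<phi> j))" for i
    using that enclosing_inherits(4)[OF j] enclosing_eq[OF \<open>distinct (atoms \<phi>)\<close> j that] atoms by auto
  have invariant: "0 \<le> h i (x \<tau>) + \<gamma> i \<tau>"
    if "i \<in> {1..M}" "0 \<le> \<tau>" "\<tau> \<le> T" "\<And>t. t \<in> {0..\<tau>} \<Longrightarrow> active h \<phi> x i t" for i \<tau>
  proof -
    have H: "hocbf f g U T (D i) (b i) (m i) (a i) (\<alpha> i)"
      using that(1) by fact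
    then have "0 < m i"
      by (simp add: hocbf_def relative_degree_def)
    then have "0 \<le> psi f (b i) (\<alpha> i) 0 (x \<tau>, \<tau>)"
      using assms(22)[OF that(1)] assms(24)[OF that(1)] that
      by (intro hocbf_invariant[OF H \<open>trajectory f g U T x0 u x\<close>, of \<tau>]) auto
    then show ?thesis
      using assms(17)[OF that(1)] by simp
  qed
  have timed: "well_timed (enclosing \<phi> j)" and negfree: "negation_free (enclosing \<phi> j)"
    and hor: "horizon (enclosing \<phi> j) \<le> T"
    using enclosing_inherits[OF j] \<open>well_timed \<phi>\<close> \<open>negation_free \<phi>\<close> \<open>T = horizon \<phi>\<close> by auto
  show "sat h x (enclosing \<phi> j)"
  proof (cases "enclosing \<phi> j")
    case (Eventually ta tb \<theta>)
    then have nf: "state_negation_free \<theta>" and t: "0 \<le> ta" "ta < tb" "tb \<le> T"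
      using timed negfree hor by auto
    show ?thesis
    proof (rule ccontr)
      \<comment> \<open>Without a common satisfaction time in the interval, no barrier of this
        subformula is deleted up to \<open>tb\<close>. All of them are then nonnegative at
        \<open>tb\<close>, where the shifts are nonpositive, so \<open>tb\<close> itself is such a
        time.\<close>
      assume unsat: "\<not> ?thesis"
      have "0 \<le> h i (x tb)" if i: "i \<in> set (state_atoms \<theta>)" for i
      proof -
        have i': "i \<in> {1..M}" "enclosing \<phi> i = Eventually ta tb \<theta>"
          using same[of i] i Eventually by auto
        have "active h \<phi> x i t" if "t \<in> {0..tb}" for t
          using unsat that by (auto simp: active_def i'(2) Eventually sat_state_negation_free[OF nf])
        then have "0 \<le> h i (x tb) + \<gamma> i tb"
          using t i'(1) by (intro invariant) auto
        moreover have "\<gamma> i tb \<le> 0"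
          using assms(16)[OF i'(1)] i'(2) F[OF i'(1)] by (rule gamma_nonpos_under_F)
        ultimately show ?thesis
          by simp
      qed
      then show False
        using unsat t by (force simp: Eventually sat_state_negation_free[OF nf])
    qed
  next
    case (Always ta tb \<theta>)
    then have nf: "state_negation_free \<theta>" and t: "0 \<le> ta" "ta < tb" "tb \<le> T"
      using timed negfree hor by auto
    have "0 \<le> h i (x r)" if i: "i \<in> set (state_atoms \<theta>)" and r: "r \<in> {ta..tb}" for i r
    proof -
      have i': "i \<in> {1..M}" "enclosing \<phi> i = Always ta tb \<theta>"
        using same[of i] i Always by auto
      \<comment> \<open>At \<open>tb\<close> the barrier is already deleted, so invariance covers
        only the half-open interval; continuity of \<open>h i\<close> along the solution adds the
        endpoint.\<close>
      have before: "0 \<le> h i (x \<tau>)" if "\<tau> \<in> {ta..<tb}" for \<tau>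
      proof -
        have "0 \<le> h i (x \<tau>) + \<gamma> i \<tau>"
          using that t i' by (intro invariant) (auto simp: active_def)
        moreover have "\<gamma> i \<tau> \<le> 0"
          using that by (intro gamma_nonpos_under_G[OF assms(16)[OF i'(1)] i'(2) G[OF i'(1)]]) auto
        ultimately show ?thesis
          by simp
      qed
      obtain L where "L-lipschitz_on {0..T} x"
        using \<open>trajectory f g U T x0 u x\<close> unfolding trajectory_def by blast
      then have "continuous_on {ta..tb} x"
        using t by (auto intro: continuous_on_subset[OF lipschitz_on_continuous_on])
      moreover have "continuous_on UNIV (h i)"
        using i'(1) by fact
      ultimately have "continuous_on (closure {ta..<tb}) (\<lambda>t. h i (x t))"
        using t continuous_on_compose2[of UNIV "h i" "{ta..tb}" x] by simp
      moreover have "r \<in> closure {ta..<tb}"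
        using r t by simp
      ultimately show ?thesis
        using before by (rule continuous_ge_on_closure)
    qed
    then show ?thesis
      by (auto simp: Always sat_state_negation_free[OF nf])
  next
    case (Conj \<phi>1 \<phi>2)
    then show ?thesis
      using enclosing_neq_Conj by blast
  qed
qed fact+

end
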